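(* If $G$ is a connected graph and $G\in\mathfrak{T}$, then $$W_\tau(G)\leq 1+\max_{P\in\mathbf{P}}\sum_{v\in V(P)} d_G(v),$$ where $\mathbf{P}$ is the set of all shortest paths in $G$ (i.e. shortest paths between pairs of vertices of $G$) and $d_G(v)$ is the degree of $v$.
   Context: All graphs are finite, undirected, without loops or multiple edges. A total coloring of a graph $G$ is an assignment of colors to the vertices and edges of $G$ such that no two adjacent vertices, no two adjacent edges, and no vertex and an edge incident to it receive the same color. For a positive integer $t$, an interval total $t$-coloring of $G$ is a total coloring of $G$ with colors $1,2,\ldots,t$ such that each color $i\in\{1,\ldots,t\}$ is used on at least one vertex or edge, and for each vertex $v$ the set consisting of the color of $v$ and the colors of the edges incident to $v$ consists of $d_G(v)+1$ consecutive integers. $\mathfrak{T}$ is the set of graphs having an interval total $t$-coloring for some $t\geq1$, and for $G\in\mathfrak{T}$, $W_\tau(G)$ is the greatest $t$ for which $G$ has an interval total $t$-coloring. *)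

theory Defs
  imports "Graph_Theory.Graph_Theory"
begin

text \<open>
  A finite simple graph is a \<^locale>\<open>pair_graph\<close>: a finite, loop-free, symmetric set of
  ordered pairs. An undirected edge \<open>uv\<close> is thus represented by both \<open>(u, v)\<close> and \<open>(v, u)\<close>;
  colors are given to the undirected edge \<open>{u, v}\<close>.
\<close>

definition edges :: "'a pair_pre_digraph \<Rightarrow> 'a set set" where
  "edges G = (\<lambda>(u, v). {u, v}) ` parcs G"

definition incident_edges :: "'a pair_pre_digraph \<Rightarrow> 'a \<Rightarrow> 'a set set" where
  "incident_edges G v = {e \<in> edges G. v \<in> e}"

text \<open>Since every edge at \<open>v\<close> gives exactly one arc leaving \<open>v\<close>, the degree is the out-degree:\<close>

lemma (in pair_graph) out_degree_eq_card_incident_edges: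
  "out_degree (with_proj G) v = card (incident_edges G v)"
proof -
  have "bij_betw (\<lambda>(u, w). {u, w}) (out_arcs (with_proj G) v) (incident_edges G v)"
    unfolding bij_betw_def
  proof
    show "inj_on (\<lambda>(u, w). {u, w}) (out_arcs (with_proj G) v)"
      by (auto simp: inj_on_def out_arcs_def doubleton_eq_iff)
    have sym: "(w, u) \<in> parcs G" if "(u, w) \<in> parcs G" for u w
      using arcs_ends_symmetric[OF sym_arcs] that by simp
    show "(\<lambda>(u, w). {u, w}) ` out_arcs (with_proj G) v = incident_edges G v"
    proof
      show "(\<lambda>(u, w). {u, w}) ` out_arcs (with_proj G) v \<subseteq> incident_edges G v"
        by (auto simp: incident_edges_def edges_def out_arcs_def)
      show "incident_edges G v \<subseteq> (\<lambda>(u, w). {u, w}) ` out_arcs (with_proj G) v"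
      proof
        fix e assume "e \<in> incident_edges G v"
        then obtain w where "e = {v, w}" "(v, w) \<in> parcs G"
          by (auto simp: incident_edges_def edges_def insert_commute dest: sym)
        then show "e \<in> (\<lambda>(u, w). {u, w}) ` out_arcs (with_proj G) v"
          by (force simp: out_arcs_def)
      qed
    qed
  qed
  then show ?thesis
    unfolding out_degree_def by (rule bij_betw_same_card)
qed

text \<open>A coloring is given by its restrictions \<open>\<alpha>\<close> to the vertices and \<open>\<beta>\<close> to the edges.\<close>

definition total_coloring ::
  "'a pair_pre_digraph \<Rightarrow> ('a \<Rightarrow> nat) \<Rightarrow> ('a set \<Rightarrow> nat) \<Rightarrow> bool" where
  "total_coloring G \<alpha> \<beta> \<longleftrightarrow>
     (\<forall>u v. (u, v) \<in> parcs G \<longrightarrow> \<alpha> u \<noteq> \<alpha> v) \<and>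
     (\<forall>e\<in>edges G. \<forall>f\<in>edges G. e \<noteq> f \<and> e \<inter> f \<noteq> {} \<longrightarrow> \<beta> e \<noteq> \<beta> f) \<and>
     (\<forall>v\<in>pverts G. \<forall>e\<in>incident_edges G v. \<alpha> v \<noteq> \<beta> e)"

definition interval_total_coloring ::
  "'a pair_pre_digraph \<Rightarrow> nat \<Rightarrow> ('a \<Rightarrow> nat) \<Rightarrow> ('a set \<Rightarrow> nat) \<Rightarrow> bool" where
  "interval_total_coloring G t \<alpha> \<beta> \<longleftrightarrow>
     total_coloring G \<alpha> \<beta> \<and>
     \<alpha> ` pverts G \<union> \<beta> ` edges G = {1..t} \<and>
     (\<forall>v\<in>pverts G. \<exists>a. insert (\<alpha> v) (\<beta> ` incident_edges G v) = {a..a + out_degree G v})"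

definition has_interval_total_coloring :: "'a pair_pre_digraph \<Rightarrow> nat \<Rightarrow> bool" where
  "has_interval_total_coloring G t \<longleftrightarrow> t \<ge> 1 \<and> (\<exists>\<alpha> \<beta>. interval_total_coloring G t \<alpha> \<beta>)"

definition interval_total_colorable :: "'a pair_pre_digraph set" (\<open>\<TT>\<close>) where
  "\<TT> = {G. pair_graph G \<and> (\<exists>t. has_interval_total_coloring G t)}"

text \<open>
  The greatest element exists for \<open>G \<in> \<TT>\<close>, as \<open>t\<close> is at most the number of vertices and edges.
\<close>

definition W_tau :: "'a pair_pre_digraph \<Rightarrow> nat" where
  "W_tau G = (GREATEST t. has_interval_total_coloring G t)"

text \<open>The endpoints may coincide: a single vertex is a shortest path of length 0.\<close>

definition shortest_paths :: "'a pair_pre_digraph \<Rightarrow> 'a vwalk set" where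
  "shortest_paths G =
     {p. vpath p G \<and>
         (\<forall>q. vpath q G \<and> hd q = hd p \<and> last q = last p \<longrightarrow> vwalk_length p \<le> vwalk_length q)}"

end

theory Submission
  imports Defs
begin

text \<open>
  At every vertex the colors form an interval \<open>{a v..a v + d v}\<close>, where \<open>d v\<close> is the degree. Adjacent
  vertices \<open>u\<close>, \<open>v\<close> share the color of the edge \<open>uv\<close>, so \<open>a v \<le> a u + d u\<close>. Summing this
  along a shortest path from a vertex that sees the color 1 to one that sees the color \<open>t\<close> gives
  \<open>t \<le> 1 + \<Sum> d\<close>.
\<close>

text \<open>The hypothesis telescopes: putting a vertex \<open>u\<close> in front of the walk adds
  \<open>d u\<close> to the bound. The term \<open>d (last p)\<close> on the left lets the sum run
  over all of \<open>p\<close> and makes the one-vertex walk a case of equality.\<close>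

lemma interval_start_le_along_vwalk:
  fixes a d :: "'a \<Rightarrow> nat"
  assumes "vwalk p H"
    and "\<And>u v. (u, v) \<in> arcs_ends H \<Longrightarrow> a v \<le> a u + d u"
  shows "a (last p) + d (last p) \<le> a (hd p) + sum_list (map d p)"
  using assms(1)
proof (induct p rule: vwalk_induct)
  case (Base u)
  then show ?case by simp
next
  case (Cons u v es)
  then show ?case using assms(2)[of u v] by simp
qed

lemma shortest_path_exists:
  assumes "vpath q (with_proj G)"
  obtains p where "p \<in> shortest_paths G" "hd p = hd q" "last p = last q"
proof -
  let ?P = "\<lambda>p. vpath p (with_proj G) \<and> hd p = hd q \<and> last p = last q"
  obtain p where "?P p" "\<forall>r. ?P r \<longrightarrow> vwalk_length p \<le> vwalk_length r"
    using ex_has_least_nat[of ?P q vwalk_length] assms by blast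
  then have "p \<in> shortest_paths G"
    by (auto simp: shortest_paths_def)
  with \<open>?P p\<close> that show thesis by blast
qed

lemma arc_in_incident_edges:
  assumes "(u, v) \<in> parcs G"
  shows "{u, v} \<in> incident_edges G u" "{u, v} \<in> incident_edges G v"
  using imageI[OF assms, of "\<lambda>(u, v). {u, v}"] by (simp_all add: incident_edges_def edges_def)

context pair_graph
begin

lemma shortest_path_between:
  assumes "connected (with_proj G)" "u \<in> pverts G" "v \<in> pverts G"
  obtains p where "p \<in> shortest_paths G" "hd p = u" "last p = v"
proof -
  \<comment> \<open>\<open>connected\<close> is about the symmetric closure; as the arcs are already
    symmetric, it gives directed reachability.\<close>
  have "strongly_connected (with_proj G)"
    using symmetric_connected_imp_strongly_connected[OF sym_arcs assms(1)] .
  then have "u \<rightarrow>\<^sup>*\<^bsub>with_proj G\<^esub> v"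
    using assms(2,3) by (auto simp: strongly_connected_def)
  then obtain w where "vwalk w (with_proj G)" "hd w = u" "last w = v"
    by (auto simp: reachable_vwalk_conv)
  then obtain q where q: "vpath q (with_proj G)" "hd q = u" "last q = v"
    using vwalk_imp_ex_vpath[of w "with_proj G" u v] by auto
  show thesis
    by (rule shortest_path_exists[OF q(1)]) (rule that, simp_all add: q)
qed

text \<open>Finiteness lets \<open>Max\<close> bound each degree sum. It holds because a path
  repeats no vertex.\<close>

lemma finite_shortest_paths: "finite (shortest_paths G)"
proof (rule finite_subset)
  show "shortest_paths G \<subseteq> {p. set p \<subseteq> pverts G \<and> distinct p}"
    by (auto simp: shortest_paths_def vpath_def vwalk_def)
  show "finite {p. set p \<subseteq> pverts G \<and> distinct p}"
    using pair_finite_verts by (rule finite_subset_distinct)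
qed

text \<open>An edge color is seen at either end of that edge. Applied to the colors 1 and
  \<open>t\<close>, this supplies the two ends of the shortest path.\<close>

lemma color_seen_at_vertex:
  assumes "interval_total_coloring G t \<alpha> \<beta>" "c \<in> {1..t}"
  obtains v where "v \<in> pverts G" "c \<in> insert (\<alpha> v) (\<beta> ` incident_edges G v)"
proof -
  have "c \<in> \<alpha> ` pverts G \<union> \<beta> ` edges G"
    using assms by (simp add: interval_total_coloring_def)
  then show thesis
  proof
    assume "c \<in> \<alpha> ` pverts G"
    with that show thesis by blast
  next
    assume "c \<in> \<beta> ` edges G"
    then obtain u w where "(u, w) \<in> parcs G" "c = \<beta> {u, w}"
      by (auto simp: edges_def)
    then have "u \<in> pverts G" "{u, w} \<in> incident_edges G u"
      using in_arcsD1 arc_in_incident_edges by simp_all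
    with that[of u] \<open>c = \<beta> {u, w}\<close> show thesis
      by simp
  qed
qed

lemma colors_le_shortest_path_degree_sum:
  assumes "connected (with_proj G)" "has_interval_total_coloring G t"
  shows "t \<le> 1 + Max ((\<lambda>P. \<Sum>v\<in>set P. out_degree (with_proj G) v) ` shortest_paths G)"
proof -
  let ?d = "out_degree (with_proj G)"
  let ?S = "\<lambda>\<alpha> \<beta> v. insert (\<alpha> v) (\<beta> ` incident_edges G v)"
  obtain \<alpha> \<beta> where "t \<ge> 1" and col: "interval_total_coloring G t \<alpha> \<beta>"
    using assms(2) by (auto simp: has_interval_total_coloring_def)
  have "\<forall>v\<in>pverts G. \<exists>a. ?S \<alpha> \<beta> v = {a..a + ?d v}"
    using col unfolding interval_total_coloring_def by blast
  from bchoice[OF this] obtain a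
    where a: "\<And>v. v \<in> pverts G \<Longrightarrow> ?S \<alpha> \<beta> v = {a v..a v + ?d v}"
    by blast
  have step: "a v \<le> a u + ?d u" if "(u, v) \<in> parcs G" for u v
  proof -
    have "{u, v} \<in> incident_edges G u" "{u, v} \<in> incident_edges G v"
      using arc_in_incident_edges[OF that] by simp_all
    then have "\<beta> {u, v} \<in> ?S \<alpha> \<beta> u" "\<beta> {u, v} \<in> ?S \<alpha> \<beta> v"
      by blast+
    then show ?thesis
      using a[of u] a[of v] in_arcsD1[OF that] in_arcsD2[OF that] by simp
  qed
  obtain u where u: "u \<in> pverts G" "1 \<in> ?S \<alpha> \<beta> u"
    using color_seen_at_vertex[OF col, of 1] \<open>t \<ge> 1\<close> by auto
  obtain v where v: "v \<in> pverts G" "t \<in> ?S \<alpha> \<beta> v"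
    using color_seen_at_vertex[OF col, of t] \<open>t \<ge> 1\<close> by auto
  \<comment> \<open>The vertices \<open>u\<close> and \<open>v\<close> may coincide; then
    \<open>p\<close> is the path \<open>[u]\<close> of length 0.\<close>
  obtain p where p: "p \<in> shortest_paths G" "hd p = u" "last p = v"
    using shortest_path_between[OF assms(1) u(1) v(1)] by blast
  then have "vwalk p (with_proj G)" "distinct p"
    by (auto simp: shortest_paths_def vpath_def)
  have "t \<le> a v + ?d v"
    using a[OF v(1)] v(2) by simp
  also have "\<dots> \<le> a u + sum_list (map ?d p)"
    using interval_start_le_along_vwalk[OF \<open>vwalk p (with_proj G)\<close>, of a ?d] step p by simp
  also have "\<dots> = a u + (\<Sum>x\<in>set p. ?d x)"
    using \<open>distinct p\<close> by (simp add: sum_list_distinct_conv_sum_set)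
  also have "\<dots> \<le> 1 + Max ((\<lambda>P. \<Sum>x\<in>set P. ?d x) ` shortest_paths G)"
  proof (rule add_mono)
    \<comment> \<open>The color 1 lies in the interval at \<open>u\<close>, so this interval starts
      no later than 1. This is the summand 1 of the bound.\<close>
    show "a u \<le> 1"
      using a[OF u(1)] u(2) by simp
    show "(\<Sum>x\<in>set p. ?d x) \<le> Max ((\<lambda>P. \<Sum>x\<in>set P. ?d x) ` shortest_paths G)"
      using p(1) finite_shortest_paths by (intro Max_ge) auto
  qed
  finally show ?thesis .
qed

end

theorem theorem4:
  fixes G :: "'a pair_pre_digraph"
  assumes "pair_graph G" and "connected G" and "G \<in> \<TT>"
  shows "W_tau G \<le> 1 + Max ((\<lambda>P. \<Sum>v\<in>set P. out_degree G v) ` shortest_paths G)"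
proof -
  interpret pair_graph G by fact
  obtain t where "has_interval_total_coloring G t"
    using assms(3) by (auto simp: interval_total_colorable_def)
  \<comment> \<open>The bound is used twice: here it shows that the admissible \<open>t\<close> are
    bounded, so that the \<open>GREATEST\<close> in \<open>W_tau\<close> is attained; afterwards it
    is applied to \<open>W_tau G\<close> itself.\<close>
  then have "has_interval_total_coloring G (W_tau G)"
    unfolding W_tau_def
    using colors_le_shortest_path_degree_sum[OF assms(2)] by (rule GreatestI_nat)
  then show ?thesis
    by (rule colors_le_shortest_path_degree_sum[OF assms(2)])
qed

end
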